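(* Let $\mathcal{F}_7$ be the class of functions $f\in\mathcal{A}$ such that $\left|f'(z)/g'(z)-1\right|<1$ for all $z\in\mathbb{D}$, for some starlike function $g\in\mathcal{A}$. Then the following sharp radius results hold (i.e. each radius below is exactly equal to the stated value): (1) for every $0\le\alpha<1$, the $\mathcal{C}(\alpha)$-radius of $\mathcal{F}_7$ is $R_{\mathcal{C}(\alpha)}(\mathcal{F}_7)=\dfrac{2(1-\alpha)}{5+\sqrt{25+4\alpha(\alpha-1)}}$; (2) the $\mathcal{UCV}$-radius of $\mathcal{F}_7$ is $R_{\mathcal{UCV}}(\mathcal{F}_7)=R_{\mathcal{C}(1/2)}(\mathcal{F}_7)=5-2\sqrt6$.
   Context: $\mathbb{D}=\{z\in\mathbb{C}:|z|<1\}$. $\mathcal{A}$ is the class of analytic functions $f$ on $\mathbb{D}$ with $f(0)=0$ and $f'(0)=1$; $\mathcal{S}\subset\mathcal{A}$ is the subclass of univalent (injective) functions. A starlike function $g\in\mathcal{A}$ is a function $g\in\mathcal{S}$ with $\operatorname{Re}(zg'(z)/g(z))>0$ on $\mathbb{D}$ (the quotient being $1$ at $z=0$). For $0\le\alpha<1$, $\mathcal{C}(\alpha)$ is the class of $f\in\mathcal{S}$ with $\operatorname{Re}(1+zf''(z)/f'(z))>\alpha$ on $\mathbb{D}$ (convex of order $\alpha$). $\mathcal{UCV}$ is the class of uniformly convex functions: $f\in\mathcal{S}$ such that for every circular arc $\gamma\subset\mathbb{D}$ with center $\zeta\in\mathbb{D}$ the image arc $f(\gamma)$ is convex; by a known theorem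 of Rønning and of Ma and Minda, $f\in\mathcal{UCV}$ if and only if $\operatorname{Re}\left(1+zf''(z)/f'(z)\right)>\left|zf''(z)/f'(z)\right|$ for all $z\in\mathbb{D}$. For families $\mathcal{G},\mathcal{F}\subset\mathcal{A}$, the $\mathcal{G}$-radius of $\mathcal{F}$, denoted $R_{\mathcal{G}}(\mathcal{F})$, is the largest number $R$ such that the function $z\mapsto r^{-1}f(rz)$ belongs to $\mathcal{G}$ for all $0<r\le R$ and all $f\in\mathcal{F}$. *)

theory Defs
  imports "HOL-Complex_Analysis.Complex_Analysis"
begin

text \<open>Functions on the open unit disk \<^term>\<open>ball 0 1 :: complex set\<close> are total functions
  \<^typ>\<open>complex \<Rightarrow> complex\<close>; membership in each class below depends only on the values on the disk.\<close>

definition class_A :: "(complex \<Rightarrow> complex) set" where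
  "class_A = {f. f holomorphic_on ball 0 1 \<and> f 0 = 0 \<and> deriv f 0 = 1}"

definition class_S :: "(complex \<Rightarrow> complex) set" where
  "class_S = {f \<in> class_A. inj_on f (ball 0 1)}"

text \<open>The origin is left out because the quotient has there a removable singularity with
  value 1, whereas the formal quotient would be \<open>0 / 0 = 0\<close>.\<close>

definition starlike_functions :: "(complex \<Rightarrow> complex) set" where
  "starlike_functions =
     {g \<in> class_S. \<forall>z \<in> ball 0 1 - {0}. Re (z * deriv g z / g z) > 0}"

definition convex_of_order :: "real \<Rightarrow> (complex \<Rightarrow> complex) set" where
  "convex_of_order \<alpha> =
     {f \<in> class_S. \<forall>z \<in> ball 0 1. Re (1 + z * deriv (deriv f) z / deriv f z) > \<alpha>}"

text \<open>A smooth arc is convex if the argument of its tangent has a continuous determination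
  \<open>\<theta>\<close> that is nondecreasing along the arc (Goodman). Since \<open>cis (\<theta> t)\<close> has
  modulus 1, the equation for \<open>sgn\<close> also forces the tangent vector to be nonzero.\<close>

definition convex_arc :: "(real \<Rightarrow> complex) \<Rightarrow> real \<Rightarrow> real \<Rightarrow> bool" where
  "convex_arc w a b \<longleftrightarrow>
     (\<exists>w' \<theta>. (\<forall>t \<in> {a..b}. (w has_vector_derivative w' t) (at t within {a..b}) \<and>
                            sgn (w' t) = cis (\<theta> t)) \<and>
             continuous_on {a..b} \<theta> \<and> mono_on {a..b} \<theta>)"

text \<open>Circular arcs are traversed counterclockwise; full circles are included.\<close>

definition circular_arc :: "complex \<Rightarrow> real \<Rightarrow> real \<Rightarrow> complex" where
  "circular_arc \<zeta> \<rho> t = \<zeta> + of_real \<rho> * cis t"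

definition UCV :: "(complex \<Rightarrow> complex) set" where
  "UCV = {f \<in> class_S. \<forall>\<zeta> \<in> ball 0 1. \<forall>\<rho> > 0. \<forall>a b.
            a < b \<and> b \<le> a + 2 * pi \<and> circular_arc \<zeta> \<rho> ` {a..b} \<subseteq> ball 0 1
            \<longrightarrow> convex_arc (f \<circ> circular_arc \<zeta> \<rho>) a b}"

definition dilation :: "real \<Rightarrow> (complex \<Rightarrow> complex) \<Rightarrow> complex \<Rightarrow> complex" where
  "dilation r f = (\<lambda>z. f (of_real r * z) / of_real r)"

text \<open>\<open>r > 1\<close> is excluded because \<open>f (r z)\<close> is then not defined on the whole disk.\<close>

definition radius_admissible ::
  "(complex \<Rightarrow> complex) set \<Rightarrow> (complex \<Rightarrow> complex) set \<Rightarrow> real \<Rightarrow> bool" where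
  "radius_admissible G F R \<longleftrightarrow>
     0 \<le> R \<and> R \<le> 1 \<and> (\<forall>r. 0 < r \<and> r \<le> R \<longrightarrow> (\<forall>f \<in> F. dilation r f \<in> G))"

text \<open>\<open>is_radius G F R\<close> says that the \<open>G\<close>-radius of \<open>F\<close> exists, i.e. that there is a largest
  admissible number, and equals \<open>R\<close>.\<close>

definition is_radius ::
  "(complex \<Rightarrow> complex) set \<Rightarrow> (complex \<Rightarrow> complex) set \<Rightarrow> real \<Rightarrow> bool" where
  "is_radius G F R \<longleftrightarrow>
     radius_admissible G F R \<and> (\<forall>R'. radius_admissible G F R' \<longrightarrow> R' \<le> R)"

definition class_F7 :: "(complex \<Rightarrow> complex) set" where
  "class_F7 =
     {f \<in> class_A. \<exists>g \<in> starlike_functions.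
        \<forall>z \<in> ball 0 1. cmod (deriv f z / deriv g z - 1) < 1}"

end

theory Submission
  imports Defs
begin

text \<open>Write \<open>p = f'/g'\<close> and \<open>q = z g'/g\<close>. Then \<open>q\<close> is a Caratheodory function (positive real part, value
  \<open>1\<close> at the origin), \<open>\<bar>p - 1\<bar> < 1\<close>, and logarithmic differentiation gives
  \<open>1 + z f''/f' = q + z q'/q + z p'/p\<close>.
  The first term lies in the disc with diameter from \<open>(1 - r)/(1 + r)\<close> to \<open>(1 + r)/(1 - r)\<close>, where
  \<open>r = \<bar>z\<bar>\<close>, and the Schwarz-Pick inequality bounds the other two terms by \<open>2r/(1 - r\<^sup>2)\<close> and
  \<open>r/(1 - r)\<close>. Hence \<open>1 + z f''/f'\<close> lies in the disc with centre \<open>(1 + r\<^sup>2)/(1 - r\<^sup>2)\<close> and radius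
  \<open>(5r + r\<^sup>2)/(1 - r\<^sup>2)\<close> (lemma \<open>class_F7_convexity_disc\<close>), whose leftmost point is
  \<open>(1 - 5r)/(1 - r\<^sup>2)\<close>. This exceeds \<open>\<alpha>\<close> for all \<open>r < R\<close> exactly if \<open>R\<close> is at most the smaller root of
  \<open>\<alpha> r\<^sup>2 - 5r + 1 - \<alpha> = 0\<close>, which is the radius in question.

  Membership in \<open>convex_of_order\<close> and \<open>UCV\<close> also demands univalence. Every radius here is at most
  \<open>1/5\<close>, and on the disc of that radius the same estimate gives \<open>\<bar>f''/f'\<bar> \<le> 35/6\<close>, so that
  \<open>\<bar>log f'\<bar> < 7/6 < \<pi>/2\<close>; thus \<open>Re f' > 0\<close> and \<open>f\<close> is injective there.

  For uniform convexity, the tangent of the image of an arc with centre \<open>\<zeta>\<close> turns at the rate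
  \<open>Re (1 + (z - \<zeta>) f''/f')\<close>. This is nonnegative for all \<open>z\<close> and \<open>\<zeta>\<close> once
  \<open>\<bar>z f''/f'\<bar> \<le> Re (1 + z f''/f')\<close>, i.e. once \<open>1 + z f''/f'\<close> stays in the parabolic region
  \<open>\<bar>w - 1\<bar> \<le> Re w\<close>. A disc with real centre \<open>a \<le> 3/2\<close> lies in that region as soon as it lies to the
  right of \<open>1/2\<close>, so the \<open>UCV\<close>-radius is at least the radius for \<open>\<alpha> = 1/2\<close>.

  The lower bound \<open>(1 - 5r)/(1 - r\<^sup>2)\<close> is attained on the negative real axis by the function with
  \<open>f' = (1 + z) g'\<close>, where \<open>g\<close> is the Koebe function: there \<open>1 + z f''/f' = (1 - 5s)/(1 - s\<^sup>2)\<close> at \<open>z = -s\<close>. For \<open>UCV\<close>, the pair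
  \<open>z, \<zeta> = -z\<close> turns the two-point condition into \<open>(1 - 5s)/(1 - s\<^sup>2) \<ge> 1/2\<close>, the condition for
  \<open>\<alpha> = 1/2\<close> again.\<close>

section \<open>Schwarz-Pick estimates for logarithmic derivatives\<close>

text \<open>Moving \<open>z\<close> and \<open>w z\<close> to the origin by disc automorphisms reduces this to the bound on the
  derivative at the origin in the Schwarz lemma.\<close>

lemma Schwarz_Pick_deriv:
  assumes holw: "w holomorphic_on ball 0 1" and w1: "\<And>z. norm z < 1 \<Longrightarrow> norm (w z) < 1"
    and z: "norm z < 1"
  shows "cmod (deriv w z) * (1 - (cmod z)\<^sup>2) \<le> 1 - (cmod (w z))\<^sup>2"
proof -
  define a where "a = w z"
  have a: "norm a < 1" using w1 z a_def by blast
  define M where "M = Moebius_function 0 (- z)"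
  define N where "N = Moebius_function 0 a"
  have sq: "(cmod z)\<^sup>2 < 1" "(cmod a)\<^sup>2 < 1"
    using z a by (simp_all add: abs_square_less_1)
  have holM: "M holomorphic_on ball 0 1" and holN: "N holomorphic_on ball 0 1"
    unfolding M_def N_def using z a by (auto intro: Moebius_function_holomorphic)
  have M1: "norm (M u) < 1" if "norm u < 1" for u
    unfolding M_def using z that by (auto intro: Moebius_function_norm_lt_1)
  have N1: "norm (N u) < 1" if "norm u < 1" for u
    unfolding N_def using a that by (auto intro: Moebius_function_norm_lt_1)
  have M0: "M 0 = z" by (simp add: M_def Moebius_function_def)
  have Na: "N a = 0" by (simp add: N_def Moebius_function_def)
  have dM: "(M has_field_derivative (1 - of_real ((cmod z)\<^sup>2))) (at 0)"
    unfolding M_def Moebius_function_def complex_norm_square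
    by (auto intro!: derivative_eq_intros simp: mult.commute)
  have ne: "1 - cnj a * a \<noteq> 0"
  proof
    assume "1 - cnj a * a = 0"
    then have "complex_of_real ((cmod a)\<^sup>2) = of_real 1"
      unfolding complex_norm_square by (simp add: mult.commute)
    then have "(cmod a)\<^sup>2 = 1" unfolding of_real_eq_iff .
    then show False using sq(2) by simp
  qed
  have dN: "(N has_field_derivative (1 / (1 - of_real ((cmod a)\<^sup>2)))) (at a)"
    unfolding N_def Moebius_function_def complex_norm_square
    using ne by (auto intro!: derivative_eq_intros simp: mult.commute)
  have dw: "(w has_field_derivative deriv w z) (at (M 0))"
    unfolding M0 by (rule holomorphic_derivI[OF holw]) (use z in auto)
  have d1: "((w \<circ> M) has_field_derivative deriv w z * (1 - of_real ((cmod z)\<^sup>2))) (at 0)"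
    by (rule DERIV_chain[OF dw dM])
  have "((N \<circ> (w \<circ> M)) has_field_derivative
      1 / (1 - of_real ((cmod a)\<^sup>2)) * (deriv w z * (1 - of_real ((cmod z)\<^sup>2)))) (at 0)"
    by (rule DERIV_chain[OF _ d1]) (use dN M0 a_def in simp)
  then have der: "deriv (N \<circ> (w \<circ> M)) 0
      = 1 / (1 - of_real ((cmod a)\<^sup>2)) * (deriv w z * (1 - of_real ((cmod z)\<^sup>2)))"
    by (rule DERIV_imp_deriv)
  have "(N \<circ> (w \<circ> M)) holomorphic_on ball 0 1"
    by (intro holomorphic_on_compose_gen[where t="ball 0 1"] holM holw holN) (use M1 w1 in auto)
  then have "norm (deriv (N \<circ> (w \<circ> M)) 0) \<le> 1"
    by (rule Schwarz_Lemma(2)[where \<xi>=0]) (use M0 Na a_def M1 w1 N1 in auto)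
  moreover have "norm (deriv (N \<circ> (w \<circ> M)) 0)
      = cmod (deriv w z) * (1 - (cmod z)\<^sup>2) / (1 - (cmod a)\<^sup>2)"
  proof -
    have "cmod (1 - of_real x) = 1 - x" if "x < 1" for x
      using that norm_of_real[of "1 - x", where 'a=complex] by simp
    from this[OF sq(1)] this[OF sq(2)] show ?thesis unfolding der norm_mult norm_divide by simp
  qed
  ultimately show ?thesis using sq by (simp add: a_def divide_simps)
qed

lemma norm_add_one_sq_minus_norm_diff_one_sq:
  "(cmod (q + 1))\<^sup>2 - (cmod (q - 1))\<^sup>2 = 4 * Re q"
  unfolding cmod_power2 by (simp add: power2_eq_square algebra_simps)

text \<open>Both bounds come from the Cayley transform \<open>w = (q - 1)/(q + 1)\<close>, a self-map of the disc fixing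
  the origin: \<open>\<bar>w z\<bar> \<le> \<bar>z\<bar>\<close> says that \<open>q z\<close> lies in an Apollonius disc, and the Schwarz-Pick
  inequality for \<open>w\<close> reads \<open>\<bar>q'\<bar> (1 - \<bar>z\<bar>\<^sup>2) \<le> 2 Re q\<close>.\<close>

lemma Caratheodory_disc_and_logderiv:
  assumes holq: "q holomorphic_on ball 0 1" and q0: "q 0 = 1"
    and Re: "\<And>z. norm z < 1 \<Longrightarrow> 0 < Re (q z)" and z: "norm z < 1"
  shows "cmod (q z - of_real ((1 + (cmod z)\<^sup>2) / (1 - (cmod z)\<^sup>2))) \<le> 2 * cmod z / (1 - (cmod z)\<^sup>2)"
    and "cmod (z * deriv q z / q z) \<le> 2 * cmod z / (1 - (cmod z)\<^sup>2)"
proof -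
  define r where "r = cmod z"
  have r: "0 \<le> r" "r < 1" "r\<^sup>2 < 1" using z by (auto simp: r_def abs_square_less_1)
  define w where "w = (\<lambda>z. (q z - 1) / (q z + 1))"
  have ne: "q u + 1 \<noteq> 0" if "norm u < 1" for u
  proof
    assume "q u + 1 = 0"
    then have "Re (q u + 1) = 0" by simp
    then show False using Re[OF that] by simp
  qed
  have nw: "1 - (cmod (w u))\<^sup>2 = 4 * Re (q u) / (cmod (q u + 1))\<^sup>2" if "norm u < 1" for u
    using norm_add_one_sq_minus_norm_diff_one_sq[of "q u"] ne[OF that]
    by (simp add: w_def norm_divide power_divide divide_simps)
  have w1: "norm (w u) < 1" if "norm u < 1" for u
  proof -
    have "0 < 4 * Re (q u) / (cmod (q u + 1))\<^sup>2"
      using Re[OF that] ne[OF that] by simp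
    then have "(cmod (w u))\<^sup>2 < 1" using nw[OF that] by linarith
    then show ?thesis by (simp add: abs_square_less_1)
  qed
  have holw: "w holomorphic_on ball 0 1"
    unfolding w_def using ne by (intro holomorphic_intros holq) auto
  have w0: "w 0 = 0" by (simp add: w_def q0)
  have "cmod (w z) \<le> r"
    unfolding r_def by (rule Schwarz_Lemma(1)[OF holw w0 w1 z])
  then have "cmod (q z - 1) \<le> r * cmod (q z + 1)"
    using ne[OF z] by (simp add: w_def norm_divide divide_simps)
  then have "(cmod (q z - 1))\<^sup>2 \<le> r\<^sup>2 * (cmod (q z + 1))\<^sup>2"
    by (metis norm_ge_zero power_mono power_mult_distrib)
  then have ineq: "((Re (q z))\<^sup>2 + (Im (q z))\<^sup>2) * (1 - r\<^sup>2) - 2 * Re (q z) * (1 + r\<^sup>2) + (1 - r\<^sup>2) \<le> 0"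
    unfolding cmod_power2 by (simp add: power2_eq_square algebra_simps)
  define A where "A = (1 + r\<^sup>2) / (1 - r\<^sup>2)"
  have A2: "A\<^sup>2 - 1 = (2 * r / (1 - r\<^sup>2))\<^sup>2"
  proof -
    have "1 - r\<^sup>2 \<noteq> 0" using r by simp
    moreover have "(1 + r\<^sup>2)\<^sup>2 - (1 - r\<^sup>2)\<^sup>2 = (2 * r)\<^sup>2" by (simp add: power2_eq_square algebra_simps)
    ultimately show ?thesis unfolding A_def power_divide
      by (metis (no_types, lifting) diff_divide_distrib divide_self power_not_zero)
  qed
  have "((Re (q z))\<^sup>2 + (Im (q z))\<^sup>2) - 2 * Re (q z) * A + 1
      = (((Re (q z))\<^sup>2 + (Im (q z))\<^sup>2) * (1 - r\<^sup>2) - 2 * Re (q z) * (1 + r\<^sup>2) + (1 - r\<^sup>2)) / (1 - r\<^sup>2)"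
  proof -
    have "1 - r\<^sup>2 \<noteq> 0" using r by simp
    then have "X - 2 * x * A + 1 = (X * (1 - r\<^sup>2) - 2 * x * (1 + r\<^sup>2) + (1 - r\<^sup>2)) / (1 - r\<^sup>2)" for X x
      unfolding A_def by (simp add: eq_divide_eq distrib_right left_diff_distrib)
    then show ?thesis by simp
  qed
  also have "\<dots> \<le> 0" using ineq r by (simp add: divide_nonpos_pos)
  finally have "(cmod (q z - of_real A))\<^sup>2 \<le> A\<^sup>2 - 1"
    unfolding cmod_power2 by (simp add: power2_eq_square algebra_simps)
  then have "(cmod (q z - of_real A))\<^sup>2 \<le> (2 * r / (1 - r\<^sup>2))\<^sup>2" using A2 by simp
  then have "cmod (q z - of_real A) \<le> 2 * r / (1 - r\<^sup>2)"
    by (rule power2_le_imp_le) (use r in auto)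
  then show "cmod (q z - of_real ((1 + (cmod z)\<^sup>2) / (1 - (cmod z)\<^sup>2))) \<le> 2 * cmod z / (1 - (cmod z)\<^sup>2)"
    by (simp add: A_def r_def)
  have dq: "(q has_field_derivative deriv q z) (at z)"
    by (rule holomorphic_derivI[OF holq]) (use z in auto)
  have "(w has_field_derivative (2 * deriv q z / (q z + 1)\<^sup>2)) (at z)"
    unfolding w_def
    using DERIV_divide[OF DERIV_diff[OF dq DERIV_const[where k=1]] DERIV_add[OF dq DERIV_const[where k=1]] ne[OF z]]
    by (simp add: power2_eq_square algebra_simps)
  then have dw: "deriv w z = 2 * deriv q z / (q z + 1)\<^sup>2" by (rule DERIV_imp_deriv)
  have "cmod (deriv w z) * (1 - r\<^sup>2) \<le> 4 * Re (q z) / (cmod (q z + 1))\<^sup>2"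
    using Schwarz_Pick_deriv[OF holw w1 z] nw[OF z] by (simp add: r_def)
  then have "2 * cmod (deriv q z) * (1 - r\<^sup>2) \<le> 4 * Re (q z)"
    using ne[OF z] by (simp add: dw norm_divide norm_mult norm_power divide_simps)
  also have "\<dots> \<le> 4 * cmod (q z)" using complex_Re_le_cmod[of "q z"] by simp
  finally have *: "cmod (deriv q z) * (1 - r\<^sup>2) \<le> 2 * cmod (q z)" by simp
  have "q z \<noteq> 0" using Re[OF z] by auto
  then have "cmod (deriv q z) / cmod (q z) \<le> 2 / (1 - r\<^sup>2)"
    using * r by (simp add: divide_simps)
  then have "r * (cmod (deriv q z) / cmod (q z)) \<le> r * (2 / (1 - r\<^sup>2))"
    by (rule mult_left_mono) (use r in auto)
  then show "cmod (z * deriv q z / q z) \<le> 2 * cmod z / (1 - (cmod z)\<^sup>2)"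
    by (simp add: norm_mult norm_divide r_def mult.commute)
qed

text \<open>The Schwarz-Pick bound \<open>1 - \<bar>p - 1\<bar>\<^sup>2\<close> factors; one factor is at most \<open>\<bar>p\<bar>\<close>, the other at most
  \<open>1 + \<bar>z\<bar>\<close> by the Schwarz lemma.\<close>

lemma logderiv_bound_disc_about_one:
  assumes holp: "p holomorphic_on ball 0 1" and p0: "p 0 = 1"
    and p1: "\<And>z. norm z < 1 \<Longrightarrow> cmod (p z - 1) < 1" and z: "norm z < 1"
  shows "cmod (z * deriv p z / p z) \<le> cmod z / (1 - cmod z)"
proof -
  define r where "r = cmod z"
  have r: "0 \<le> r" "r < 1" "r\<^sup>2 < 1" using z by (auto simp: r_def abs_square_less_1)
  have holw: "(\<lambda>z. p z - 1) holomorphic_on ball 0 1" by (intro holomorphic_intros holp)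
  have "((\<lambda>z. p z - 1) has_field_derivative deriv p z) (at z)"
    by (rule derivative_eq_intros holomorphic_derivI[OF holp] refl)+ (use z in auto)
  then have dw: "deriv (\<lambda>z. p z - 1) z = deriv p z" by (rule DERIV_imp_deriv)
  have s: "cmod (p z - 1) \<le> r"
    unfolding r_def using Schwarz_Lemma(1)[OF holw _ p1 z] p0 by simp
  have pz: "1 - cmod (p z - 1) \<le> cmod (p z)"
    using norm_triangle_ineq4[of "p z" "p z - 1"] by simp
  have "p z \<noteq> 0" using p1[OF z] by auto
  have "cmod (deriv p z) * ((1 - r) * (1 + r)) \<le> (1 - cmod (p z - 1)) * (1 + cmod (p z - 1))"
    using Schwarz_Pick_deriv[OF holw p1 z] unfolding dw
    by (simp add: r_def power2_eq_square algebra_simps)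
  also have "\<dots> \<le> cmod (p z) * (1 + r)"
    using pz s by (intro mult_mono) auto
  finally have "(cmod (deriv p z) * (1 - r)) * (1 + r) \<le> cmod (p z) * (1 + r)"
    by (simp add: mult.assoc)
  then have "cmod (deriv p z) * (1 - r) \<le> cmod (p z)"
    using r by simp
  then have "cmod (deriv p z) / cmod (p z) \<le> 1 / (1 - r)"
    using r \<open>p z \<noteq> 0\<close> by (simp add: divide_simps)
  then have "r * (cmod (deriv p z) / cmod (p z)) \<le> r * (1 / (1 - r))"
    by (rule mult_left_mono) (use r in auto)
  then show ?thesis by (simp add: norm_mult norm_divide r_def)
qed

section \<open>The class in terms of Caratheodory functions\<close>

text \<open>With \<open>g z = z k z\<close>, the function \<open>q = g'/k\<close> is \<open>z g'/g\<close> with the singularity at the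
  origin removed; the last equation is logarithmic differentiation of \<open>g' = q k\<close>, using
  \<open>q = 1 + z k'/k\<close>.\<close>

lemma starlike_Caratheodory:
  assumes "g \<in> starlike_functions"
  obtains q where "q holomorphic_on ball 0 1" "q 0 = 1" "\<And>z. norm z < 1 \<Longrightarrow> 0 < Re (q z)"
    "\<And>z. norm z < 1 \<Longrightarrow> deriv g z \<noteq> 0"
    "\<And>z. norm z < 1 \<Longrightarrow> 1 + z * deriv (deriv g) z / deriv g z = q z + z * deriv q z / q z"
proof -
  have holg: "g holomorphic_on ball 0 1" and g0: "g 0 = 0" and dg0: "deriv g 0 = 1"
    and pos: "\<And>z. z \<in> ball 0 1 - {0} \<Longrightarrow> Re (z * deriv g z / g z) > 0"
    using assms by (auto simp: starlike_functions_def class_S_def class_A_def)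
  obtain k where holk: "k holomorphic_on ball 0 1" and gk: "\<And>z. norm z < 1 \<Longrightarrow> g z = z * k z"
    and k0: "deriv g 0 = k 0"
    using Schwarz3[OF holg g0] by metis
  have kne: "k z \<noteq> 0" if "norm z < 1" for z
  proof (cases "z = 0")
    case False
    then show ?thesis using pos[of z] gk[OF that] that by auto
  qed (use k0 dg0 in auto)
  have dk: "(k has_field_derivative deriv k z) (at z)" if "norm z < 1" for z
    by (rule holomorphic_derivI[OF holk]) (use that in auto)
  have dg: "deriv g z = k z + z * deriv k z" if "norm z < 1" for z
  proof -
    have "((\<lambda>z. z * k z) has_field_derivative k z + z * deriv k z) (at z)"
      using DERIV_mult[OF DERIV_ident dk[OF that]] by (simp add: ac_simps)
    then have "(g has_field_derivative k z + z * deriv k z) (at z)"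
      by (rule has_field_derivative_transform_within_open[where S="ball 0 1"]) (use that gk in auto)
    then show ?thesis by (rule DERIV_imp_deriv)
  qed
  define q where "q = (\<lambda>z. deriv g z / k z)"
  have holq: "q holomorphic_on ball 0 1"
    unfolding q_def using kne by (intro holomorphic_intros holomorphic_deriv holg holk) auto
  have q0: "q 0 = 1" by (simp add: q_def k0[symmetric] dg0)
  have Re: "0 < Re (q z)" if "norm z < 1" for z
  proof (cases "z = 0")
    case False
    then show ?thesis using pos[of z] gk[OF that] that by (simp add: q_def)
  qed (use q0 in auto)
  have qne: "q z \<noteq> 0" if "norm z < 1" for z using Re[OF that] by auto
  have dg_ne: "deriv g z \<noteq> 0" if "norm z < 1" for z using qne[OF that] by (auto simp: q_def)
  have eq: "1 + z * deriv (deriv g) z / deriv g z = q z + z * deriv q z / q z" if z: "norm z < 1" for z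
  proof -
    have gq: "deriv g u = q u * k u" if "norm u < 1" for u using kne[OF that] by (simp add: q_def)
    have "((\<lambda>z. q z * k z) has_field_derivative deriv q z * k z + q z * deriv k z) (at z)"
      using DERIV_mult[OF holomorphic_derivI[OF holq] dk[OF z]] z by (simp add: ac_simps)
    then have "(deriv g has_field_derivative deriv q z * k z + q z * deriv k z) (at z)"
      by (rule has_field_derivative_transform_within_open[where S="ball 0 1"]) (use z gq in auto)
    then have "deriv (deriv g) z = deriv q z * k z + q z * deriv k z" by (rule DERIV_imp_deriv)
    moreover have "q z = 1 + z * deriv k z / k z" using dg[OF z] kne[OF z] by (simp add: q_def divide_simps)
    moreover have "z * (deriv q z * k z + q z * deriv k z) / (q z * k z)
        = z * deriv q z / q z + z * deriv k z / k z"
      using kne[OF z] qne[OF z] by (simp add: divide_simps) (simp add: algebra_simps)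
    ultimately show ?thesis
      using gq[OF z] by simp
  qed
  show ?thesis by (rule that[OF holq q0 Re dg_ne eq])
qed

text \<open>The centre is that of the disc containing \<open>q\<close>; its radius is the sum of the bounds
  \<open>2r\<close>, \<open>2r\<close> and \<open>r (1 + r)\<close>, all over \<open>1 - r\<^sup>2\<close>, for the three terms of
  \<open>1 + z f''/f' = q + z q'/q + z p'/p\<close>.\<close>

lemma class_F7_convexity_disc:
  assumes f: "f \<in> class_F7" and z: "norm z < 1"
  shows "deriv f z \<noteq> 0"
    and "cmod (1 + z * deriv (deriv f) z / deriv f z
               - of_real ((1 + (cmod z)\<^sup>2) / (1 - (cmod z)\<^sup>2)))
         \<le> (5 * cmod z + (cmod z)\<^sup>2) / (1 - (cmod z)\<^sup>2)"
proof -
  define r where "r = cmod z"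
  have r: "0 \<le> r" "r < 1" "r\<^sup>2 < 1" using z by (auto simp: r_def abs_square_less_1)
  have holf: "f holomorphic_on ball 0 1" and df0: "deriv f 0 = 1"
    using f by (auto simp: class_F7_def class_A_def)
  obtain g where g: "g \<in> starlike_functions"
    and fg: "\<And>z. norm z < 1 \<Longrightarrow> cmod (deriv f z / deriv g z - 1) < 1"
    using f by (auto simp: class_F7_def)
  have holg: "g holomorphic_on ball 0 1" and dg0: "deriv g 0 = 1"
    using g by (auto simp: starlike_functions_def class_S_def class_A_def)
  obtain q where holq: "q holomorphic_on ball 0 1" and q0: "q 0 = 1"
    and Req: "\<And>z. norm z < 1 \<Longrightarrow> 0 < Re (q z)"
    and dgne: "\<And>z. norm z < 1 \<Longrightarrow> deriv g z \<noteq> 0"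
    and eqg: "\<And>z. norm z < 1 \<Longrightarrow> 1 + z * deriv (deriv g) z / deriv g z = q z + z * deriv q z / q z"
    using starlike_Caratheodory[OF g] by blast
  define p where "p = (\<lambda>z. deriv f z / deriv g z)"
  have hdg: "deriv g holomorphic_on ball 0 1" by (intro holomorphic_deriv holg) auto
  have holp: "p holomorphic_on ball 0 1"
    unfolding p_def using dgne by (intro holomorphic_intros holomorphic_deriv holf hdg) auto
  have p0: "p 0 = 1" by (simp add: p_def df0 dg0)
  have p1: "cmod (p z - 1) < 1" if "norm z < 1" for z using fg[OF that] by (simp add: p_def)
  have pne: "p z \<noteq> 0" if "norm z < 1" for z using p1[OF that] by auto
  then show dfne: "deriv f z \<noteq> 0" using z by (auto simp: p_def)
  have fp: "deriv f u = p u * deriv g u" if "norm u < 1" for u using dgne[OF that] by (simp add: p_def)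
  have "((\<lambda>z. p z * deriv g z) has_field_derivative deriv p z * deriv g z + p z * deriv (deriv g) z) (at z)"
    using DERIV_mult[OF holomorphic_derivI[OF holp] holomorphic_derivI[OF hdg], of z UNIV] z by (simp add: ac_simps)
  then have "(deriv f has_field_derivative deriv p z * deriv g z + p z * deriv (deriv g) z) (at z)"
    by (rule has_field_derivative_transform_within_open[where S="ball 0 1"]) (use z fp in auto)
  then have ddf: "deriv (deriv f) z = deriv p z * deriv g z + p z * deriv (deriv g) z"
    by (rule DERIV_imp_deriv)
  have "1 + z * deriv (deriv f) z / deriv f z
      = (1 + z * deriv (deriv g) z / deriv g z) + z * deriv p z / p z"
    using pne[OF z] dgne[OF z] fp[OF z] by (simp add: ddf field_simps)
  then have eq: "1 + z * deriv (deriv f) z / deriv f z = q z + z * deriv q z / q z + z * deriv p z / p z"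
    using eqg[OF z] by simp
  define A where "A = complex_of_real ((1 + r\<^sup>2) / (1 - r\<^sup>2))"
  have "cmod (1 + z * deriv (deriv f) z / deriv f z - A)
      \<le> cmod (q z - A) + cmod (z * deriv q z / q z) + cmod (z * deriv p z / p z)"
    unfolding eq by (rule order_trans[OF _ norm_triangle_mono[OF norm_triangle_ineq order_refl]])
      (simp add: algebra_simps)
  also have "\<dots> \<le> 2 * r / (1 - r\<^sup>2) + 2 * r / (1 - r\<^sup>2) + r / (1 - r)"
    using Caratheodory_disc_and_logderiv[OF holq q0 Req z]
      logderiv_bound_disc_about_one[OF holp p0 p1 z]
    unfolding A_def r_def[symmetric] by linarith
  also have "r / (1 - r) = r * (1 + r) / (1 - r\<^sup>2)"
    using r by (simp add: power2_eq_square divide_simps) (simp add: algebra_simps)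
  also have "2 * r / (1 - r\<^sup>2) + 2 * r / (1 - r\<^sup>2) + r * (1 + r) / (1 - r\<^sup>2) = (5 * r + r\<^sup>2) / (1 - r\<^sup>2)"
    by (simp add: add_divide_distrib[symmetric] power2_eq_square algebra_simps)
  finally show "cmod (1 + z * deriv (deriv f) z / deriv f z
               - of_real ((1 + (cmod z)\<^sup>2) / (1 - (cmod z)\<^sup>2)))
         \<le> (5 * cmod z + (cmod z)\<^sup>2) / (1 - (cmod z)\<^sup>2)"
    by (simp add: A_def r_def)
qed

section \<open>Uniform convexity as a two-point condition\<close>

lemma has_vector_derivative_cis: "(cis has_vector_derivative \<i> * cis t) (at t within S)"
  using has_derivative_cis[OF has_derivative_ident, of t S] unfolding has_vector_derivative_def by simp

lemma has_vector_derivative_circular_arc: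
  "(circular_arc \<zeta> \<rho> has_vector_derivative \<i> * of_real \<rho> * cis t) (at t within S)"
  unfolding circular_arc_def by (auto intro!: derivative_eq_intros has_vector_derivative_cis simp: scaleR_conv_of_real)

lemma has_vector_derivative_comp_arc:
  assumes "f holomorphic_on ball 0 1" "circular_arc \<zeta> \<rho> t \<in> ball 0 1"
  shows "((\<lambda>t. f (circular_arc \<zeta> \<rho> t)) has_vector_derivative
           \<i> * of_real \<rho> * cis t * deriv f (circular_arc \<zeta> \<rho> t)) (at t within S)"
proof -
  have "(f has_field_derivative deriv f (circular_arc \<zeta> \<rho> t)) (at (circular_arc \<zeta> \<rho> t))"
    by (rule holomorphic_derivI[OF assms(1)]) (use assms in auto)
  from field_vector_diff_chain_within[OF has_vector_derivative_circular_arc[of \<zeta> \<rho> t S]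
      has_field_derivative_at_within[OF this]]
  show ?thesis by (simp add: o_def)
qed

text \<open>The real part is the rate at which the tangent of the image turns when \<open>z\<close> is passed on the
  circle around \<open>\<zeta>\<close>. To avoid choosing branches of the argument, the tangent \<open>V t\<close> is compared
  with its initial value: for a nondecreasing angle \<open>\<theta>\<close>, the quotient \<open>V t / V t0\<close> has argument in
  \<open>[0, \<pi>)\<close> shortly after \<open>t0\<close>, so its imaginary part is nonnegative there, whereas a negative turning
  rate is a negative derivative of that imaginary part.\<close>

lemma UCV_imp_two_point:
  assumes f: "f \<in> UCV" and z: "norm z < 1" and \<zeta>: "norm \<zeta> < 1" and "z \<noteq> \<zeta>"
  shows "0 \<le> Re (1 + (z - \<zeta>) * deriv (deriv f) z / deriv f z)"
proof (rule ccontr)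
  assume neg: "\<not> ?thesis"
  have fS: "f \<in> class_S" using f by (simp add: UCV_def)
  then have holf: "f holomorphic_on ball 0 1" and inj: "inj_on f (ball 0 1)"
    by (auto simp: class_S_def class_A_def)
  have hdf: "deriv f holomorphic_on ball 0 1" by (intro holomorphic_deriv holf) auto
  define \<rho> where "\<rho> = cmod (z - \<zeta>)"
  define t0 where "t0 = Arg (z - \<zeta>)"
  define \<gamma> where "\<gamma> = circular_arc \<zeta> \<rho>"
  have \<rho>: "\<rho> > 0" using \<open>z \<noteq> \<zeta>\<close> by (simp add: \<rho>_def)
  have rc: "of_real \<rho> * cis t0 = z - \<zeta>"
    using rcis_cmod_Arg[of "z - \<zeta>"] by (simp add: rcis_def \<rho>_def t0_def)
  have \<gamma>0: "\<gamma> t0 = z" using rc by (simp add: \<gamma>_def circular_arc_def)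
  have cont\<gamma>: "continuous_on UNIV \<gamma>"
    unfolding \<gamma>_def circular_arc_def by (intro continuous_intros)
  have "open (\<gamma> -` ball 0 1)" by (rule open_vimage[OF open_ball cont\<gamma>])
  moreover have "t0 \<in> \<gamma> -` ball 0 1" using \<gamma>0 z by simp
  ultimately obtain e where e: "e > 0" "cball t0 e \<subseteq> \<gamma> -` ball 0 1"
    using open_contains_cball by blast
  \<comment> \<open>An arc that starts at \<open>z\<close> suffices, and a short one stays in the disc.\<close>
  define b where "b = t0 + min e pi"
  have b: "t0 < b" "b \<le> t0 + 2 * pi" using e pi_gt_zero by (simp_all add: b_def min_def del: pi_gt_zero)
  have sub: "\<gamma> t \<in> ball 0 1" if "t \<in> {t0..b}" for t
  proof -
    have "t \<in> cball t0 e" using that by (auto simp: b_def dist_real_def)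
    then show ?thesis using e by blast
  qed
  have "\<gamma> ` {t0..b} \<subseteq> ball 0 1" using sub by blast
  then have "convex_arc (f \<circ> \<gamma>) t0 b"
    using f \<rho> b \<zeta> unfolding UCV_def \<gamma>_def by auto
  then obtain w' \<theta> where w': "\<And>t. t \<in> {t0..b} \<Longrightarrow> ((f \<circ> \<gamma>) has_vector_derivative w' t) (at t within {t0..b})"
    and sg: "\<And>t. t \<in> {t0..b} \<Longrightarrow> sgn (w' t) = cis (\<theta> t)"
    and c\<theta>: "continuous_on {t0..b} \<theta>" and m\<theta>: "mono_on {t0..b} \<theta>"
    unfolding convex_arc_def by blast
  define V where "V = (\<lambda>t. \<i> * of_real \<rho> * cis t * deriv f (\<gamma> t))"
  have wV: "w' t = V t" if t: "t \<in> {t0..b}" for t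
  proof -
    have "((f \<circ> \<gamma>) has_vector_derivative V t) (at t within {t0..b})"
      using has_vector_derivative_comp_arc[OF holf, of \<zeta> \<rho> t "{t0..b}"] sub[OF t]
      by (simp add: V_def \<gamma>_def o_def)
    then show ?thesis
      using vector_derivative_unique_within_closed_interval[of t0 b t] w'[OF t] b t by auto
  qed
  have dfz: "deriv f z \<noteq> 0"
    by (rule holomorphic_injective_imp_regular[OF holf open_ball inj]) (use z in auto)
  have V0: "V t0 \<noteq> 0" using \<rho> dfz by (simp add: V_def \<gamma>0)
  define h where "h = (\<lambda>t. Im (V t / V t0))"
  have dV: "(V has_vector_derivative V t0 * (\<i> * (1 + (z - \<zeta>) * deriv (deriv f) z / deriv f z))) (at t0)"
  proof -
    have "((\<lambda>t. deriv f (\<gamma> t)) has_vector_derivative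
           \<i> * of_real \<rho> * cis t0 * deriv (deriv f) z) (at t0)"
      using has_vector_derivative_comp_arc[OF hdf, of \<zeta> \<rho> t0 UNIV] z \<gamma>0 by (simp add: \<gamma>_def)
    moreover have "((\<lambda>t. \<i> * of_real \<rho> * cis t) has_vector_derivative \<i> * of_real \<rho> * (\<i> * cis t0)) (at t0)"
      by (auto intro!: derivative_eq_intros has_vector_derivative_cis simp: scaleR_conv_of_real)
    ultimately have "(V has_vector_derivative (\<i> * of_real \<rho> * cis t0) * (\<i> * of_real \<rho> * cis t0 * deriv (deriv f) z)
        + \<i> * of_real \<rho> * (\<i> * cis t0) * deriv f (\<gamma> t0)) (at t0)"
      unfolding V_def by (rule has_vector_derivative_mult[rotated])
    moreover have "(\<i> * of_real \<rho> * cis t0) * (\<i> * of_real \<rho> * cis t0 * deriv (deriv f) z)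
        + \<i> * of_real \<rho> * (\<i> * cis t0) * deriv f (\<gamma> t0)
        = V t0 * (\<i> * (1 + (z - \<zeta>) * deriv (deriv f) z / deriv f z))"
      using dfz unfolding V_def \<gamma>0 rc[symmetric] by (simp add: field_simps)
    ultimately show ?thesis by simp
  qed
  have "((\<lambda>t. V t * (1 / V t0)) has_vector_derivative
      V t0 * (\<i> * (1 + (z - \<zeta>) * deriv (deriv f) z / deriv f z)) * (1 / V t0)) (at t0)"
    by (rule has_vector_derivative_mult_left[OF dV])
  then have "((\<lambda>t. V t / V t0) has_vector_derivative
      \<i> * (1 + (z - \<zeta>) * deriv (deriv f) z / deriv f z)) (at t0)"
    using V0 by simp
  from has_field_derivative_Im[OF this]
  have "(h has_field_derivative Re (1 + (z - \<zeta>) * deriv (deriv f) z / deriv f z)) (at t0)"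
    unfolding h_def by simp
  from DERIV_neg_dec_right[OF this] neg
  obtain d where d: "d > 0" "\<And>k. 0 < k \<Longrightarrow> k < d \<Longrightarrow> h (t0 + k) < h t0"
    by (auto simp: not_le)
  have h0: "h t0 = 0" using V0 by (simp add: h_def)
  have "\<exists>d>0. \<forall>t\<in>{t0..b}. dist t t0 < d \<longrightarrow> dist (\<theta> t) (\<theta> t0) < pi"
    using c\<theta> b by (auto simp: continuous_on_iff)
  then obtain d' where d': "d' > 0" "\<And>t. t \<in> {t0..b} \<Longrightarrow> dist t t0 < d' \<Longrightarrow> dist (\<theta> t) (\<theta> t0) < pi"
    by blast
  define k where "k = min (min d d' / 2) (b - t0)"
  have k: "0 < k" "k < d" "k < d'" "t0 + k \<in> {t0..b}"
    using d(1) d'(1) b by (auto simp: k_def)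
  define t where "t = t0 + k"
  have t: "t \<in> {t0..b}" "dist t t0 < d'" using k by (auto simp: t_def dist_real_def)
  have t0: "t0 \<in> {t0..b}" using b by simp
  have th: "0 \<le> \<theta> t - \<theta> t0" "\<theta> t - \<theta> t0 < pi"
    using d'(2)[OF t] mono_onD[OF m\<theta> t0 t(1)] k by (auto simp: dist_real_def t_def)
  have pol: "V s = of_real (cmod (V s)) * cis (\<theta> s)" if "s \<in> {t0..b}" for s
  proof -
    have "V s = of_real (cmod (V s)) * sgn (V s)" by (simp add: sgn_eq)
    then show ?thesis using sg[OF that] wV[OF that] by simp
  qed
  have "V t / V t0 = of_real (cmod (V t) / cmod (V t0)) * cis (\<theta> t - \<theta> t0)"
    by (subst pol[OF t(1)], subst pol[OF t0]) (simp add: cis_divide[symmetric])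
  then have "h t = cmod (V t) / cmod (V t0) * sin (\<theta> t - \<theta> t0)"
    unfolding h_def by simp
  then have "h t \<ge> 0" using sin_ge_zero[of "\<theta> t - \<theta> t0"] th by simp
  then show False using d(2)[OF k(1,2)] h0 by (simp add: t_def)
qed

text \<open>A branch of \<open>log f'\<close>: its imaginary part is the argument of the tangent below, and its modulus
  controls univalence later.\<close>

lemma holomorphic_log_deriv:
  assumes holf: "f holomorphic_on ball 0 1" and ne: "\<And>z. z \<in> ball 0 1 \<Longrightarrow> deriv f z \<noteq> 0"
  obtains L where "L holomorphic_on ball 0 1" "\<And>z. z \<in> ball 0 1 \<Longrightarrow> exp (L z) = deriv f z"
    "\<And>z. z \<in> ball 0 1 \<Longrightarrow> deriv L z = deriv (deriv f) z / deriv f z"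
proof -
  have hdf: "deriv f holomorphic_on ball 0 1" by (intro holomorphic_deriv holf) auto
  obtain L where holL: "L holomorphic_on ball 0 1" and expL: "\<And>z. z \<in> ball 0 1 \<Longrightarrow> exp (L z) = deriv f z"
    using holomorphic_logarithm_exists[OF convex_ball open_ball hdf ne, of 0] by auto
  have dL: "deriv L z = deriv (deriv f) z / deriv f z" if z: "z \<in> ball 0 1" for z
  proof -
    have "((\<lambda>z. exp (L z)) has_field_derivative exp (L z) * deriv L z) (at z)"
      by (rule DERIV_chain2[OF DERIV_exp holomorphic_derivI[OF holL open_ball z]])
    then have "(deriv f has_field_derivative exp (L z) * deriv L z) (at z)"
      by (rule has_field_derivative_transform_within_open[where S="ball 0 1"]) (use z expL in auto)
    then have "deriv (deriv f) z = deriv f z * deriv L z"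
      using DERIV_imp_deriv expL[OF z] by metis
    then show ?thesis using ne[OF z] by simp
  qed
  show ?thesis by (rule that[OF holL expL dL])
qed

text \<open>The two-point condition \<open>0 \<le> Re (1 + (z - \<zeta>) f''/f')\<close> is immediate from the hypothesis if
  \<open>\<bar>\<zeta>\<bar> \<le> \<bar>z\<bar>\<close>. For \<open>\<bar>z\<bar> < \<bar>\<zeta>\<bar>\<close> it follows by the minimum principle for the harmonic
  left-hand side in \<open>z\<close>, applied on the disc of radius \<open>\<bar>\<zeta>\<bar>\<close>, on whose boundary the first case applies.
  The condition then makes \<open>\<pi>/2 + t + Im (log f')\<close> a nondecreasing tangent angle.\<close>

lemma UCV_if_norm_le_Re:
  assumes fS: "f \<in> class_S"
    and H: "\<And>z. norm z < 1 \<Longrightarrow> cmod (z * deriv (deriv f) z / deriv f z) \<le> Re (1 + z * deriv (deriv f) z / deriv f z)"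
  shows "f \<in> UCV"
proof -
  have holf: "f holomorphic_on ball 0 1" and inj: "inj_on f (ball 0 1)"
    using fS by (auto simp: class_S_def class_A_def)
  have hdf: "deriv f holomorphic_on ball 0 1" by (intro holomorphic_deriv holf) auto
  have dfne: "deriv f z \<noteq> 0" if "z \<in> ball 0 1" for z
    by (rule holomorphic_injective_imp_regular[OF holf open_ball inj that])
  define Q where "Q = (\<lambda>z. deriv (deriv f) z / deriv f z)"
  have holQ: "Q holomorphic_on ball 0 1"
    unfolding Q_def using dfne by (intro holomorphic_intros holomorphic_deriv hdf) auto
  have HQ: "cmod (z * Q z) \<le> Re (1 + z * Q z)" if "norm z < 1" for z
    using H[OF that] by (simp add: Q_def)
  have outer: "0 \<le> Re (1 + (z - \<zeta>) * Q z)" if z: "norm z < 1" and le: "norm \<zeta> \<le> norm z" for z \<zeta>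
  proof -
    have "Re (\<zeta> * Q z) \<le> cmod (\<zeta> * Q z)" by (rule complex_Re_le_cmod)
    also have "\<dots> \<le> cmod (z * Q z)" unfolding norm_mult by (rule mult_right_mono[OF le]) simp
    also have "\<dots> \<le> Re (1 + z * Q z)" by (rule HQ[OF z])
    finally show ?thesis by (simp add: algebra_simps)
  qed
  have two: "0 \<le> Re (1 + (z - \<zeta>) * Q z)" if z: "norm z < 1" and \<zeta>: "norm \<zeta> < 1" for z \<zeta>
  proof (cases "norm \<zeta> \<le> norm z")
    case True
    then show ?thesis by (rule outer[OF z])
  next
    case False
    define S :: "complex set" where "S = ball 0 (norm \<zeta>)"
    have pos: "norm \<zeta> > 0" using False by (meson le_less_trans norm_ge_zero not_le)
    have cl: "closure S = cball 0 (norm \<zeta>)" and fr: "frontier S = sphere 0 (norm \<zeta>)"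
      using pos by (simp_all add: S_def)
    have sub: "cball 0 (norm \<zeta>) \<subseteq> ball 0 1" using \<zeta> by auto
    have hol: "(\<lambda>z. - (1 + (z - \<zeta>) * Q z)) holomorphic_on ball 0 1"
      by (intro holomorphic_intros holQ)
    have "Re (- (1 + (z - \<zeta>) * Q z)) \<le> 0"
    proof (rule maximum_real_frontier[where S = S and f = "\<lambda>z. - (1 + (z - \<zeta>) * Q z)"])
      show "(\<lambda>z. - (1 + (z - \<zeta>) * Q z)) holomorphic_on interior S"
        using sub by (intro holomorphic_on_subset[OF hol]) (auto simp: S_def)
      show "continuous_on (closure S) (\<lambda>z. - (1 + (z - \<zeta>) * Q z))"
        unfolding cl by (rule continuous_on_subset[OF holomorphic_on_imp_continuous_on[OF hol] sub])
      show "Re (- (1 + (u - \<zeta>) * Q u)) \<le> 0" if "u \<in> frontier S" for u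
        using outer[of u \<zeta>] that \<zeta> by (simp add: fr)
    qed (use False in \<open>auto simp: S_def\<close>)
    then show ?thesis by simp
  qed
  obtain L where holL: "L holomorphic_on ball 0 1"
    and expL: "\<And>z. z \<in> ball 0 1 \<Longrightarrow> exp (L z) = deriv f z"
    and dL: "\<And>z. z \<in> ball 0 1 \<Longrightarrow> deriv L z = Q z"
    unfolding Q_def using holomorphic_log_deriv[OF holf dfne] by blast
  have "convex_arc (f \<circ> circular_arc \<zeta> \<rho>) a b"
    if \<zeta>: "\<zeta> \<in> ball 0 1" and \<rho>: "\<rho> > 0" and ab: "a < b"
      and sub: "circular_arc \<zeta> \<rho> ` {a..b} \<subseteq> ball 0 1" for \<zeta> \<rho> a b
  proof -
    define \<gamma> where "\<gamma> = circular_arc \<zeta> \<rho>"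
    define \<theta> where "\<theta> = (\<lambda>t. pi / 2 + t + Im (L (\<gamma> t)))"
    have \<gamma>D: "\<gamma> t \<in> ball 0 1" if "t \<in> {a..b}" for t using sub that unfolding \<gamma>_def by blast
    have d\<theta>: "(\<theta> has_field_derivative Re (1 + (\<gamma> t - \<zeta>) * Q (\<gamma> t))) (at t)" if t: "t \<in> {a..b}" for t
    proof -
      have "((\<lambda>t. L (\<gamma> t)) has_vector_derivative \<i> * of_real \<rho> * cis t * Q (\<gamma> t)) (at t)"
        using has_vector_derivative_comp_arc[OF holL, of \<zeta> \<rho> t UNIV] \<gamma>D[OF t] dL[OF \<gamma>D[OF t]]
        by (simp add: \<gamma>_def)
      then have "((\<lambda>t. Im (L (\<gamma> t))) has_field_derivative Im (\<i> * of_real \<rho> * cis t * Q (\<gamma> t))) (at t)"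
        by (rule has_field_derivative_Im)
      then have "(\<theta> has_field_derivative 1 + Im (\<i> * of_real \<rho> * cis t * Q (\<gamma> t))) (at t)"
        using DERIV_add[OF DERIV_add[OF DERIV_const[where k="pi / 2"] DERIV_ident]] unfolding \<theta>_def by fastforce
      moreover have "\<i> * of_real \<rho> * cis t * Q (\<gamma> t) = \<i> * ((\<gamma> t - \<zeta>) * Q (\<gamma> t))"
        by (simp add: \<gamma>_def circular_arc_def)
      ultimately show ?thesis by simp
    qed
    have "((f \<circ> \<gamma>) has_vector_derivative \<i> * of_real \<rho> * cis t * deriv f (\<gamma> t)) (at t within {a..b})
        \<and> sgn (\<i> * of_real \<rho> * cis t * deriv f (\<gamma> t)) = cis (\<theta> t)" if t: "t \<in> {a..b}" for t
    proof
      show "((f \<circ> \<gamma>) has_vector_derivative \<i> * of_real \<rho> * cis t * deriv f (\<gamma> t)) (at t within {a..b})"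
        using has_vector_derivative_comp_arc[OF holf, of \<zeta> \<rho> t "{a..b}"] \<gamma>D[OF t]
        by (simp add: \<gamma>_def o_def)
      have "sgn (deriv f (\<gamma> t)) = cis (Im (L (\<gamma> t)))"
        unfolding expL[OF \<gamma>D[OF t], symmetric] exp_eq_polar[of "L (\<gamma> t)"] sgn_mult sgn_of_real by simp
      moreover have "sgn (of_real \<rho> :: complex) = 1" using \<rho> by (simp add: sgn_of_real)
      moreover have "sgn \<i> = cis (pi / 2)" by (simp add: complex_eq_iff sgn_div_norm)
      ultimately show "sgn (\<i> * of_real \<rho> * cis t * deriv f (\<gamma> t)) = cis (\<theta> t)"
        unfolding sgn_mult by (simp add: \<theta>_def cis_mult[symmetric])
    qed
    moreover have "continuous_on {a..b} \<theta>"
      by (rule continuous_at_imp_continuous_on) (use d\<theta> DERIV_isCont in blast)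
    moreover have "mono_on {a..b} \<theta>"
    proof (rule mono_onI)
      fix s t assume st: "s \<in> {a..b}" "t \<in> {a..b}" "s \<le> t"
      show "\<theta> s \<le> \<theta> t"
      proof (rule DERIV_nonneg_imp_nondecreasing[OF st(3)])
        fix x assume "s \<le> x" "x \<le> t"
        then have x: "x \<in> {a..b}" using st by auto
        show "\<exists>y. (\<theta> has_real_derivative y) (at x) \<and> 0 \<le> y"
          using d\<theta>[OF x] two[of "\<gamma> x" \<zeta>] \<gamma>D[OF x] \<zeta> by auto
      qed
    qed
    ultimately show ?thesis
      unfolding convex_arc_def \<gamma>_def[symmetric]
      by (intro exI[of _ "\<lambda>t. \<i> * of_real \<rho> * cis t * deriv f (\<gamma> t)"] exI[of _ \<theta>]) blast
  qed
  then show ?thesis using fS unfolding UCV_def by blast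
qed

section \<open>Dilations and univalence\<close>

lemma dilation_derivatives:
  assumes holf: "f holomorphic_on ball 0 1" and r: "0 < r" "r \<le> 1"
  shows "dilation r f holomorphic_on ball 0 1"
    and "norm z < 1 \<Longrightarrow> deriv (dilation r f) z = deriv f (of_real r * z)"
    and "norm z < 1 \<Longrightarrow> deriv (deriv (dilation r f)) z = of_real r * deriv (deriv f) (of_real r * z)"
proof -
  have rz: "of_real r * z \<in> ball 0 1" if "norm z < 1" for z :: complex
    using mult_mono[of r 1 "norm z" "norm z"] that r by (simp add: norm_mult)
  have hdf: "deriv f holomorphic_on ball 0 1" by (intro holomorphic_deriv holf) auto
  have lin: "((\<lambda>z. of_real r * z) has_field_derivative of_real r) (at z)" for z :: complex
    by (auto intro!: derivative_eq_intros)
  have D: "(dilation r f has_field_derivative deriv f (of_real r * z)) (at z)" if "norm z < 1" for z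
    using DERIV_cdivide[OF DERIV_chain2[OF holomorphic_derivI[OF holf open_ball rz[OF that]] lin], of "of_real r"] r
    unfolding dilation_def by simp
  show "dilation r f holomorphic_on ball 0 1"
    unfolding holomorphic_on_open[OF open_ball] by (intro ballI exI, rule D) simp
  show d1: "deriv (dilation r f) z = deriv f (of_real r * z)" if "norm z < 1" for z
    by (rule DERIV_imp_deriv[OF D[OF that]])
  show "deriv (deriv (dilation r f)) z = of_real r * deriv (deriv f) (of_real r * z)" if z: "norm z < 1"
  proof -
    have "((\<lambda>z. deriv f (of_real r * z)) has_field_derivative of_real r * deriv (deriv f) (of_real r * z)) (at z)"
      using DERIV_chain2[OF holomorphic_derivI[OF hdf open_ball rz[OF z]] lin] by (simp add: mult.commute)
    then have "(deriv (dilation r f) has_field_derivative of_real r * deriv (deriv f) (of_real r * z)) (at z)"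
      by (rule has_field_derivative_transform_within_open[where S="ball 0 1"]) (use z d1 in auto)
    then show ?thesis by (rule DERIV_imp_deriv)
  qed
qed

text \<open>The free factor \<open>c\<close> is \<open>z\<close> for convexity of some order, and \<open>z - \<zeta>\<close> for uniform convexity.\<close>

lemma dilation_logderiv:
  assumes "f holomorphic_on ball 0 1" "0 < r" "r \<le> 1" "norm z < 1"
  shows "c * deriv (deriv (dilation r f)) z / deriv (dilation r f) z
    = (of_real r * c) * deriv (deriv f) (of_real r * z) / deriv f (of_real r * z)"
  using dilation_derivatives[OF assms(1-3)] assms(4) by simp

lemma dilation_class_S:
  assumes f: "f \<in> class_A" and r: "0 < r" "r \<le> 1" and inj: "inj_on f (ball 0 r)"
  shows "dilation r f \<in> class_S"
proof -
  have holf: "f holomorphic_on ball 0 1" and f0: "f 0 = 0" and df0: "deriv f 0 = 1"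
    using f by (auto simp: class_A_def)
  have "inj_on (dilation r f) (ball 0 1)"
  proof (rule inj_onI)
    fix x y :: complex assume xy: "x \<in> ball 0 1" "y \<in> ball 0 1" "dilation r f x = dilation r f y"
    then have "f (of_real r * x) = f (of_real r * y)" using r by (simp add: dilation_def)
    moreover have "of_real r * x \<in> ball 0 r" "of_real r * y \<in> ball 0 r"
      using xy r by (simp_all add: norm_mult)
    ultimately have "of_real r * x = of_real r * y" using inj by (meson inj_onD)
    then show "x = y" using r by simp
  qed
  then show ?thesis
    using dilation_derivatives[OF holf r] f0 df0 by (simp add: class_S_def class_A_def dilation_def)
qed

text \<open>The Noshiro-Warschawski theorem: if \<open>f x = f y\<close>, the mean value theorem for the real part of
  \<open>f / (y - x)\<close> on the segment from \<open>x\<close> to \<open>y\<close> yields a zero of \<open>Re f'\<close>.\<close>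

lemma Re_deriv_pos_imp_inj_on:
  assumes S: "convex S" and d: "\<And>z. z \<in> S \<Longrightarrow> (f has_field_derivative f' z) (at z)"
    and pos: "\<And>z. z \<in> S \<Longrightarrow> 0 < Re (f' z)"
  shows "inj_on f S"
proof (rule inj_onI, rule ccontr)
  fix x y assume xy: "x \<in> S" "y \<in> S" "f x = f y" "x \<noteq> y"
  have seg: "closed_segment x y \<subseteq> S" using S xy by (simp add: closed_segment_subset)
  have "((\<lambda>z. f z / (y - x)) has_field_derivative f' u / (y - x)) (at u)" if "u \<in> closed_segment x y" for u
    using seg that by (intro DERIV_cdivide d) auto
  from complex_mvt_line[of x y "\<lambda>z. f z / (y - x)" "\<lambda>u. f' u / (y - x)", OF this]
  obtain u where u: "u \<in> closed_segment x y"
    and eq: "Re (f y / (y - x)) - Re (f x / (y - x)) = Re (f' u / (y - x) * (y - x))"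
    by blast
  have "Re (f' u) = 0" using eq xy by simp
  then show False using pos[of u] u seg by auto
qed

text \<open>The disc for \<open>1 + z f''/f'\<close> gives \<open>\<bar>f''/f'\<bar> \<le> (5 + 3r)/(1 - r\<^sup>2)\<close> away from the origin, and the
  right-hand side is \<open>35/6\<close> at \<open>r = 1/5\<close>. The factor \<open>z\<close> carries no information at the origin, where the bound
  is obtained by continuity.\<close>

lemma class_F7_preSchwarzian:
  assumes f: "f \<in> class_F7" and z: "norm z \<le> 1/5"
  shows "cmod (deriv (deriv f) z / deriv f z) \<le> 35/6"
proof -
  define Q where "Q = (\<lambda>z. deriv (deriv f) z / deriv f z)"
  have holf: "f holomorphic_on ball 0 1" using f by (auto simp: class_F7_def class_A_def)
  have hdf: "deriv f holomorphic_on ball 0 1" by (intro holomorphic_deriv holf) auto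
  have holQ: "Q holomorphic_on ball 0 1"
    unfolding Q_def using class_F7_convexity_disc(1)[OF f] by (intro holomorphic_intros holomorphic_deriv hdf) auto
  have off: "cmod (Q z) \<le> 35/6" if z: "norm z \<le> 1/5" "z \<noteq> 0" for z
  proof -
    define r where "r = cmod z"
    have r: "0 < r" "r \<le> 1/5" using z by (auto simp: r_def)
    have r2: "r\<^sup>2 \<le> 1/25" using power_mono[of r "1/5" 2] r by (simp add: power2_eq_square)
    define A where "A = (1 + r\<^sup>2) / (1 - r\<^sup>2)"
    have "cmod (z * Q z) = cmod ((1 + z * Q z - of_real A) + of_real (A - 1))" by simp
    also have "\<dots> \<le> cmod (1 + z * Q z - of_real A) + cmod (of_real (A - 1))"
      by (rule norm_triangle_ineq)
    also have "cmod (1 + z * Q z - of_real A) \<le> (5 * r + r\<^sup>2) / (1 - r\<^sup>2)"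
      using class_F7_convexity_disc(2)[OF f, of z] z unfolding Q_def A_def r_def by simp
    also have "cmod (of_real (A - 1)) = 2 * r\<^sup>2 / (1 - r\<^sup>2)"
    proof -
      have "A - 1 = 2 * r\<^sup>2 / (1 - r\<^sup>2)" using r2 by (simp add: A_def divide_simps)
      moreover have "0 \<le> 2 * r\<^sup>2 / (1 - r\<^sup>2)" using r2 by simp
      ultimately show ?thesis unfolding norm_of_real by (simp only: abs_of_nonneg)
    qed
    finally have "r * cmod (Q z) \<le> (5 * r + r\<^sup>2) / (1 - r\<^sup>2) + 2 * r\<^sup>2 / (1 - r\<^sup>2)"
      by (simp add: norm_mult r_def)
    also have "\<dots> = r * ((5 + 3 * r) / (1 - r\<^sup>2))"
      by (simp add: add_divide_distrib[symmetric] power2_eq_square algebra_simps)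
    finally have "cmod (Q z) \<le> (5 + 3 * r) / (1 - r\<^sup>2)" by (rule mult_left_le_imp_le) (rule r(1))
    also have "\<dots> \<le> 35/6" using r r2 by (simp add: divide_simps)
    finally show ?thesis .
  qed
  have "cmod (Q 0) \<le> 35/6"
  proof (rule Lim_norm_ubound[of "at 0" Q])
    have "isCont Q 0"
      using holomorphic_on_imp_continuous_on[OF holQ] by (simp add: continuous_on_eq_continuous_at)
    then show "(Q \<longlongrightarrow> Q 0) (at 0)" by (simp add: isCont_def)
    show "\<forall>\<^sub>F x in at 0. cmod (Q x) \<le> 35/6"
      using off by (auto simp: eventually_at intro!: exI[of _ "1/5"])
  qed simp
  then show ?thesis using off[OF z] by (cases "z = 0") (auto simp: Q_def)
qed

text \<open>Integrating the previous bound along a radius, \<open>log f'\<close> has modulus less than \<open>7/6\<close>; hence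
  \<open>\<bar>arg f'\<bar> < \<pi>/2\<close>, i.e. \<open>Re f' > 0\<close>.\<close>

lemma class_F7_inj_on:
  assumes f: "f \<in> class_F7"
  shows "inj_on f (ball 0 (1/5))"
proof (rule Re_deriv_pos_imp_inj_on[where f' = "deriv f"])
  have holf: "f holomorphic_on ball 0 1" and df0: "deriv f 0 = 1"
    using f by (auto simp: class_F7_def class_A_def)
  have dfne: "deriv f z \<noteq> 0" if "z \<in> ball 0 1" for z
    using class_F7_convexity_disc(1)[OF f, of z] that by simp
  obtain L where holL: "L holomorphic_on ball 0 1"
    and expL: "\<And>z. z \<in> ball 0 1 \<Longrightarrow> exp (L z) = deriv f z"
    and dL: "\<And>z. z \<in> ball 0 1 \<Longrightarrow> deriv L z = deriv (deriv f) z / deriv f z"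
    using holomorphic_log_deriv[OF holf dfne] by blast
  show "convex (ball (0::complex) (1/5))" by (rule convex_ball)
  show "(f has_field_derivative deriv f z) (at z)" if "z \<in> ball 0 (1/5)" for z
    by (rule holomorphic_derivI[OF holf]) (use that in auto)
  show "0 < Re (deriv f z)" if z: "z \<in> ball 0 (1/5)" for z
  proof -
    have der: "(L has_field_derivative deriv L u) (at u within ball 0 (1/5))" if "u \<in> ball 0 (1/5)" for u
      by (rule has_field_derivative_at_within, rule holomorphic_derivI[OF holL]) (use that in auto)
    have bound: "norm (deriv L u) \<le> 35/6" if "u \<in> ball 0 (1/5)" for u
      using class_F7_preSchwarzian[OF f, of u] dL[of u] that by simp
    have "norm (L z - L 0) \<le> 35/6 * norm (z - 0)"
      by (rule field_differentiable_bound[OF convex_ball der bound]) (use z in simp_all)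
    also have "\<dots> < 3/2" using z by simp
    finally have "\<bar>Im (L z - L 0)\<bar> < 3/2" using abs_Im_le_cmod[of "L z - L 0"] by linarith
    also have "(3/2 :: real) < pi/2" using pi_gt3 by simp
    finally have "cos (Im (L z - L 0)) > 0" by (intro cos_gt_zero_pi) linarith+
    moreover have "deriv f z = exp (L z - L 0)"
      unfolding exp_diff using expL[of z] expL[of 0] z df0 by simp
    ultimately show ?thesis by (simp add: Re_exp)
  qed
qed

section \<open>Dilations that are convex of some order or uniformly convex\<close>

lemma class_F7_dilation_class_S:
  assumes f: "f \<in> class_F7" and r: "0 < r" "r \<le> 1/5"
  shows "dilation r f \<in> class_S"
proof (rule dilation_class_S)
  show "f \<in> class_A" using f by (simp add: class_F7_def)
  show "inj_on f (ball 0 r)"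
    by (rule inj_on_subset[OF class_F7_inj_on[OF f]]) (use r in auto)
qed (use r in auto)

lemma class_F7_dilation_convex_of_order:
  assumes f: "f \<in> class_F7" and r: "0 < r" "r \<le> 1/5"
    and \<alpha>: "\<And>s. 0 \<le> s \<Longrightarrow> s < r \<Longrightarrow> \<alpha> * (1 - s\<^sup>2) < 1 - 5 * s"
  shows "dilation r f \<in> convex_of_order \<alpha>"
  unfolding convex_of_order_def
proof (intro CollectI conjI ballI class_F7_dilation_class_S[OF f r])
  fix z :: complex assume "z \<in> ball 0 1"
  then have z: "norm z < 1" by simp
  define u where "u = of_real r * z"
  define s where "s = cmod u"
  have holf: "f holomorphic_on ball 0 1" using f by (auto simp: class_F7_def class_A_def)
  have s: "0 \<le> s" "s < r" using r z by (auto simp: s_def u_def norm_mult)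
  have s1: "s < 1" "1 - s\<^sup>2 > 0" using s r by (auto simp: abs_square_less_1)
  define w where "w = 1 + u * deriv (deriv f) u / deriv f u"
  have "1 + z * deriv (deriv (dilation r f)) z / deriv (dilation r f) z = w"
    using dilation_logderiv[OF holf, of r z z] r z by (simp add: w_def u_def)
  moreover have "(1 - 5 * s) / (1 - s\<^sup>2) \<le> Re w"
  proof -
    have "- Re (w - of_real ((1 + s\<^sup>2) / (1 - s\<^sup>2))) \<le> (5 * s + s\<^sup>2) / (1 - s\<^sup>2)"
      using class_F7_convexity_disc(2)[OF f, of u] s1 abs_Re_le_cmod[of "w - of_real ((1 + s\<^sup>2) / (1 - s\<^sup>2))"]
      by (simp add: w_def s_def)
    then have "(1 + s\<^sup>2) / (1 - s\<^sup>2) - (5 * s + s\<^sup>2) / (1 - s\<^sup>2) \<le> Re w" by simp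
    then show ?thesis unfolding diff_divide_distrib[symmetric] by simp
  qed
  moreover have "\<alpha> < (1 - 5 * s) / (1 - s\<^sup>2)"
    using \<alpha>[OF s] s1 by (simp add: pos_less_divide_eq)
  ultimately show "\<alpha> < Re (1 + z * deriv (deriv (dilation r f)) z / deriv (dilation r f) z)"
    by simp
qed

text \<open>The points of the disc satisfy \<open>y\<^sup>2 \<le> (x - 1/2) (2a - 1/2 - x)\<close>, those of the parabolic region
  \<open>y\<^sup>2 \<le> 2 (x - 1/2)\<close>; for \<open>x \<ge> 1/2\<close> and \<open>a \<le> 3/2\<close> the first bound is the smaller one.\<close>

lemma disc_in_parabola:
  assumes a: "1/2 < a" "a \<le> 3/2" and w: "cmod (w - of_real a) \<le> a - 1/2"
  shows "cmod (w - 1) \<le> Re w"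
proof -
  have x: "1/2 \<le> Re w" using abs_Re_le_cmod[of "w - of_real a"] w by simp
  have "(Re w - a)\<^sup>2 + (Im w)\<^sup>2 \<le> (a - 1/2)\<^sup>2"
    using power_mono[OF w, of 2] by (simp add: cmod_power2)
  moreover have "0 \<le> (Re w - 1/2) * (Re w - 1/2 + (3 - 2 * a))"
    using x a by simp
  moreover have "(Re w)\<^sup>2 - ((Re w - 1)\<^sup>2 + (Im w)\<^sup>2)
      = ((a - 1/2)\<^sup>2 - ((Re w - a)\<^sup>2 + (Im w)\<^sup>2)) + (Re w - 1/2) * (Re w - 1/2 + (3 - 2 * a))"
    by (simp add: power2_eq_square field_simps)
  ultimately have "(Re w - 1)\<^sup>2 + (Im w)\<^sup>2 \<le> (Re w)\<^sup>2" by linarith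
  then have "(cmod (w - 1))\<^sup>2 \<le> (Re w)\<^sup>2" by (simp add: cmod_power2)
  then show ?thesis by (rule power2_le_imp_le) (use x in auto)
qed

text \<open>The hypothesis \<open>half\<close> puts the disc for \<open>1 + z f''/f'\<close> to the right of \<open>1/2\<close>; its centre
  \<open>(1 + s\<^sup>2)/(1 - s\<^sup>2)\<close> is at most \<open>3/2\<close> since \<open>s \<le> 1/5\<close>.\<close>

lemma class_F7_dilation_UCV:
  assumes f: "f \<in> class_F7" and r: "0 < r" "r \<le> 1/5"
    and half: "\<And>s. 0 \<le> s \<Longrightarrow> s < r \<Longrightarrow> 1/2 * (1 - s\<^sup>2) < 1 - 5 * s"
  shows "dilation r f \<in> UCV"
proof (rule UCV_if_norm_le_Re[OF class_F7_dilation_class_S[OF f r]])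
  fix z :: complex assume z: "norm z < 1"
  define u where "u = of_real r * z"
  define s where "s = cmod u"
  have holf: "f holomorphic_on ball 0 1" using f by (auto simp: class_F7_def class_A_def)
  have s: "0 \<le> s" "s < r" using r z by (auto simp: s_def u_def norm_mult)
  have s1: "s < 1" "s \<le> 1/5" using s r by auto
  have s2: "s\<^sup>2 \<le> 1/25" using power_mono[of s "1/5" 2] s s1 by (simp add: power2_eq_square)
  define w where "w = 1 + u * deriv (deriv f) u / deriv f u"
  define a where "a = (1 + s\<^sup>2) / (1 - s\<^sup>2)"
  have eq: "1 + z * deriv (deriv (dilation r f)) z / deriv (dilation r f) z = w"
    using dilation_logderiv[OF holf, of r z z] r z by (simp add: w_def u_def)
  have "cmod (w - of_real a) \<le> (5 * s + s\<^sup>2) / (1 - s\<^sup>2)"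
    using class_F7_convexity_disc(2)[OF f, of u] s1 by (simp add: w_def s_def a_def)
  also have "\<dots> \<le> (1/2 + 3/2 * s\<^sup>2) / (1 - s\<^sup>2)"
    using half[OF s] s2 by (intro divide_right_mono) (simp_all add: algebra_simps)
  also have "\<dots> = a - 1/2"
    using s2 by (simp add: a_def divide_simps)
  finally have "cmod (w - 1) \<le> Re w"
    by (intro disc_in_parabola[of a]) (use s2 in \<open>auto simp: a_def field_simps intro: add_pos_nonneg\<close>)
  then show "cmod (z * deriv (deriv (dilation r f)) z / deriv (dilation r f) z)
    \<le> Re (1 + z * deriv (deriv (dilation r f)) z / deriv (dilation r f) z)"
    unfolding eq[symmetric] by simp
qed

section \<open>The extremal function\<close>

definition Koebe :: "complex \<Rightarrow> complex" where
  "Koebe z = z / (1 - z)\<^sup>2"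

text \<open>The primitive of \<open>(1 + z)\<^sup>2/(1 - z)\<^sup>3\<close>, i.e. of \<open>1 + z\<close> times the derivative of the Koebe
  function, that vanishes at the origin.\<close>

definition F7_extremal :: "complex \<Rightarrow> complex" where
  "F7_extremal z = 2 / (1 - z)\<^sup>2 - 4 / (1 - z) - Ln (1 - z) + 2"

lemma unit_disc_one_pm_nonzero:
  fixes z :: complex assumes "norm z < 1"
  shows "1 - z \<noteq> 0" "1 + z \<noteq> 0" "0 < Re (1 - z)"
proof -
  show 1: "0 < Re (1 - z)" using complex_Re_le_cmod[of z] assms by simp
  show "1 - z \<noteq> 0" using assms by auto
  show "1 + z \<noteq> 0" using assms by (auto simp: add_eq_0_iff)
qed

lemma Koebe_deriv:
  assumes z: "norm z < 1"
  shows "(Koebe has_field_derivative (1 + z) / (1 - z) ^ 3) (at z)"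
proof -
  have n: "1 - z \<noteq> 0" using unit_disc_one_pm_nonzero[OF z] by simp
  have "((\<lambda>z. z / (1 - z)\<^sup>2) has_field_derivative
      (1 * (1 - z)\<^sup>2 - z * (2 * (0 - 1) * (1 - z))) / ((1 - z)\<^sup>2 * (1 - z)\<^sup>2)) (at z)"
    using n by (intro DERIV_divide) (auto intro!: derivative_eq_intros)
  moreover have "(1 * (1 - z)\<^sup>2 - z * (2 * (0 - 1) * (1 - z))) = (1 + z) * (1 - z)"
    by (simp add: power2_eq_square algebra_simps)
  moreover have "(1 + z) * (1 - z) / ((1 - z)\<^sup>2 * (1 - z)\<^sup>2) = (1 + z) / (1 - z) ^ 3"
    using n by (simp add: power2_eq_square power3_eq_cube)
  ultimately show ?thesis unfolding Koebe_def[abs_def] by simp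
qed

lemma Koebe_starlike: "Koebe \<in> starlike_functions"
proof -
  have d: "deriv Koebe z = (1 + z) / (1 - z) ^ 3" if "norm z < 1" for z
    by (rule DERIV_imp_deriv[OF Koebe_deriv[OF that]])
  have "Koebe holomorphic_on ball 0 1"
    unfolding holomorphic_on_open[OF open_ball] by (intro ballI exI, rule Koebe_deriv) simp
  moreover have "Koebe 0 = 0" by (simp add: Koebe_def)
  moreover have "inj_on Koebe (ball 0 1)"
  proof (rule inj_onI)
    fix z w :: complex assume zw: "z \<in> ball 0 1" "w \<in> ball 0 1" "Koebe z = Koebe w"
    then have "z * (1 - w)\<^sup>2 = w * (1 - z)\<^sup>2"
      using unit_disc_one_pm_nonzero[of z] unit_disc_one_pm_nonzero[of w] by (simp add: Koebe_def frac_eq_eq)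
    then have "(z - w) * (1 - z * w) = 0" by (simp add: power2_eq_square algebra_simps)
    moreover have "norm (z * w) < 1" using norm_mult_less[of z 1 w 1] zw by simp
    then have "1 - z * w \<noteq> 0" by auto
    ultimately show "z = w" by simp
  qed
  moreover have "0 < Re (z * deriv Koebe z / Koebe z)" if z: "z \<in> ball 0 1 - {0}" for z
  proof -
    have n: "1 - z \<noteq> 0" "norm z < 1" "z \<noteq> 0" using unit_disc_one_pm_nonzero[of z] z by auto
    have "z * deriv Koebe z / Koebe z = (1 + z) / (1 - z)"
      using n by (simp add: d Koebe_def power2_eq_square power3_eq_cube)
    also have "\<dots> = (1 + z) * cnj (1 - z) / of_real ((cmod (1 - z))\<^sup>2)"
      by (rule complex_div_cnj[unfolded of_real_power[symmetric]])
    also have "Re \<dots> = (1 - (cmod z)\<^sup>2) / (cmod (1 - z))\<^sup>2"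
      unfolding Re_divide_of_real cmod_power2[of z] by (simp add: power2_eq_square algebra_simps)
    also have "\<dots> > 0" using n by (simp add: abs_square_less_1)
    finally show ?thesis .
  qed
  ultimately show ?thesis
    by (simp add: starlike_functions_def class_S_def class_A_def d)
qed

lemma F7_extremal_deriv:
  assumes z: "norm z < 1"
  shows "(F7_extremal has_field_derivative (1 + z)\<^sup>2 / (1 - z) ^ 3) (at z)"
proof -
  have n: "1 - z \<noteq> 0" "0 < Re (1 - z)" using unit_disc_one_pm_nonzero[OF z] by auto
  have Ln: "1 - z \<notin> \<real>\<^sub>\<le>\<^sub>0" using n(2) by (auto simp: complex_nonpos_Reals_iff)
  have "((\<lambda>z. 2 / (1 - z)\<^sup>2 - 4 / (1 - z) - Ln (1 - z) + 2) has_field_derivative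
     4 / (1 - z) ^ 3 - 4 / (1 - z)\<^sup>2 + 1 / (1 - z)) (at z)"
  proof -
    have "(4 - 4 * z) / ((1 - z) * (1 - z) * ((1 - z) * (1 - z))) = 4 / ((1 - z) * (1 - z) * (1 - z))"
      using n by (simp add: divide_simps)
    then show ?thesis
      using n Ln by (auto intro!: derivative_eq_intros simp: power2_eq_square power3_eq_cube inverse_eq_divide)
  qed
  moreover have "4 / (1 - z) ^ 3 - 4 / (1 - z)\<^sup>2 + 1 / (1 - z) = (1 + z)\<^sup>2 / (1 - z) ^ 3"
    using n(1) by (simp add: divide_simps) (simp add: eval_nat_numeral algebra_simps)
  ultimately show ?thesis unfolding F7_extremal_def[abs_def] by simp
qed

lemma F7_extremal_holomorphic: "F7_extremal holomorphic_on ball 0 1"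
  unfolding holomorphic_on_open[OF open_ball] by (intro ballI exI, rule F7_extremal_deriv) simp

lemma F7_extremal_in_class: "F7_extremal \<in> class_F7"
proof -
  have d: "deriv F7_extremal z = (1 + z)\<^sup>2 / (1 - z) ^ 3" if "norm z < 1" for z
    by (rule DERIV_imp_deriv[OF F7_extremal_deriv[OF that]])
  have dk: "deriv Koebe z = (1 + z) / (1 - z) ^ 3" if "norm z < 1" for z
    by (rule DERIV_imp_deriv[OF Koebe_deriv[OF that]])
  have "cmod (deriv F7_extremal z / deriv Koebe z - 1) < 1" if z: "norm z < 1" for z
    using unit_disc_one_pm_nonzero[OF z] z by (simp add: d dk power2_eq_square)
  then show ?thesis
    using Koebe_starlike F7_extremal_holomorphic
    by (auto simp: class_F7_def class_A_def d F7_extremal_def intro!: bexI[of _ Koebe])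
qed

text \<open>From \<open>f''/f' = 2/(1 + z) + 3/(1 - z)\<close>: equality in the lower estimate for \<open>Re (1 + z f''/f')\<close>.\<close>

lemma F7_extremal_convexity:
  assumes s: "0 \<le> s" "s < 1"
  shows "1 + of_real (- s) * deriv (deriv F7_extremal) (of_real (- s)) / deriv F7_extremal (of_real (- s))
    = of_real ((1 - 5 * s) / (1 - s\<^sup>2))"
proof -
  have d: "deriv F7_extremal z = (1 + z)\<^sup>2 / (1 - z) ^ 3" if "norm z < 1" for z
    by (rule DERIV_imp_deriv[OF F7_extremal_deriv[OF that]])
  define z where "z = complex_of_real (- s)"
  have z: "norm z < 1" using s by (simp add: z_def)
  have n: "1 - z \<noteq> 0" "1 + z \<noteq> 0" using unit_disc_one_pm_nonzero[OF z] by auto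
  have "((\<lambda>z. (1 + z)\<^sup>2 / (1 - z) ^ 3) has_field_derivative
      (2 * (1 + z) * (1 - z) ^ 3 - (1 + z)\<^sup>2 * (- 3 * (1 - z)\<^sup>2)) / ((1 - z) ^ 3 * (1 - z) ^ 3)) (at z)"
    using n by (intro DERIV_divide) (auto intro!: derivative_eq_intros)
  moreover have "(2 * (1 + z) * (1 - z) ^ 3 - (1 + z)\<^sup>2 * (- 3 * (1 - z)\<^sup>2)) / ((1 - z) ^ 3 * (1 - z) ^ 3)
      = (1 + z)\<^sup>2 / (1 - z) ^ 3 * (2 / (1 + z) + 3 / (1 - z))"
  proof -
    have "(2 * a * b ^ 3 - a\<^sup>2 * (- 3 * b\<^sup>2)) / (b ^ 3 * b ^ 3) = a\<^sup>2 / b ^ 3 * (2 / a + 3 / b)"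
      if "a \<noteq> 0" "b \<noteq> 0" for a b :: complex
      using that by (simp add: divide_simps) (simp add: eval_nat_numeral algebra_simps)
    then show ?thesis using n by blast
  qed
  ultimately have "(deriv F7_extremal has_field_derivative (1 + z)\<^sup>2 / (1 - z) ^ 3 * (2 / (1 + z) + 3 / (1 - z))) (at z)"
    using has_field_derivative_transform_within_open[where S="ball 0 1" and g="deriv F7_extremal"] z d by auto
  then have dd: "deriv (deriv F7_extremal) z = (1 + z)\<^sup>2 / (1 - z) ^ 3 * (2 / (1 + z) + 3 / (1 - z))"
    by (rule DERIV_imp_deriv)
  have "1 + z * deriv (deriv F7_extremal) z / deriv F7_extremal z = 1 + z * (2 / (1 + z) + 3 / (1 - z))"
    using n by (simp add: dd d[OF z])
  also have "\<dots> = (1 + 5 * z) / (1 - z\<^sup>2)"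
  proof -
    have "1 - z\<^sup>2 = (1 - z) * (1 + z)" by (simp add: power2_eq_square algebra_simps)
    then show ?thesis using n by (simp add: divide_simps) (simp add: algebra_simps)
  qed
  also have "\<dots> = of_real ((1 - 5 * s) / (1 - s\<^sup>2))" by (simp add: z_def)
  finally show ?thesis by (simp only: z_def)
qed

text \<open>The point \<open>-R/R'\<close> of the unit disc is dilated to \<open>-R\<close>.\<close>

lemma F7_extremal_dilation_convex_imp:
  assumes R: "0 \<le> R" "R < R'" "R' \<le> 1"
    and conv: "dilation R' F7_extremal \<in> convex_of_order \<alpha>"
  shows "\<alpha> < (1 - 5 * R) / (1 - R\<^sup>2)"
proof -
  define z where "z = complex_of_real (- R / R')"
  have z: "norm z < 1" using R by (simp add: z_def norm_divide)
  have Rz: "of_real R' * z = of_real (- R)" using R by (simp add: z_def)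
  have "z * deriv (deriv (dilation R' F7_extremal)) z / deriv (dilation R' F7_extremal) z
     = of_real (- R) * deriv (deriv F7_extremal) (of_real (- R)) / deriv F7_extremal (of_real (- R))"
    using dilation_logderiv[OF F7_extremal_holomorphic, of R' z z] R z unfolding Rz by simp
  then have "1 + z * deriv (deriv (dilation R' F7_extremal)) z / deriv (dilation R' F7_extremal) z
     = of_real ((1 - 5 * R) / (1 - R\<^sup>2))"
    using F7_extremal_convexity[of R] R by simp
  moreover have "\<alpha> < Re (1 + z * deriv (deriv (dilation R' F7_extremal)) z / deriv (dilation R' F7_extremal) z)"
    using conv z by (simp add: convex_of_order_def)
  ultimately show ?thesis by simp
qed

text \<open>For the antipodal pair \<open>\<zeta> = -z\<close> the two-point condition is
  \<open>0 \<le> 2 Re (1 + z f''/f') - 1\<close>, taken at the point \<open>z = -s/R'\<close>, which is dilated to \<open>-s\<close>.\<close>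

lemma F7_extremal_dilation_UCV_imp:
  assumes s: "0 < s" "s < R'" "R' \<le> 1" and ucv: "dilation R' F7_extremal \<in> UCV"
  shows "1/2 \<le> (1 - 5 * s) / (1 - s\<^sup>2)"
proof -
  define z where "z = complex_of_real (- s / R')"
  have z: "norm z < 1" "z \<noteq> - z" using s by (auto simp: z_def norm_divide)
  have Rz: "of_real R' * z = of_real (- s)" using s by (simp add: z_def)
  define Q where "Q = of_real (- s) * deriv (deriv F7_extremal) (of_real (- s)) / deriv F7_extremal (of_real (- s))"
  have two: "of_real R' * (z - (- z)) = 2 * of_real (- s)" unfolding Rz[symmetric] by simp
  have "0 \<le> Re (1 + (z - (- z)) * deriv (deriv (dilation R' F7_extremal)) z / deriv (dilation R' F7_extremal) z)"
    by (rule UCV_imp_two_point[OF ucv]) (use z in auto)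
  also have "(z - (- z)) * deriv (deriv (dilation R' F7_extremal)) z / deriv (dilation R' F7_extremal) z
     = 2 * of_real (- s) * deriv (deriv F7_extremal) (of_real (- s)) / deriv F7_extremal (of_real (- s))"
    using dilation_logderiv[OF F7_extremal_holomorphic, of R' z "z - (- z)"] s z unfolding two Rz by simp
  also have "1 + \<dots> = 2 * (1 + Q) - 1" by (simp add: Q_def)
  also have "1 + Q = of_real ((1 - 5 * s) / (1 - s\<^sup>2))"
    unfolding Q_def by (rule F7_extremal_convexity) (use s in auto)
  finally show ?thesis by simp
qed

section \<open>The radii\<close>

text \<open>The number \<open>R\<close> is the smaller root of \<open>\<alpha> r\<^sup>2 - 5r + (1 - \<alpha>)\<close>, with the usual formula
  rationalised so that it stays meaningful for \<open>\<alpha> = 0\<close>.\<close>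

lemma radius_quadratic:
  fixes \<alpha> :: real
  assumes \<alpha>: "0 \<le> \<alpha>" "\<alpha> < 1"
  defines "R \<equiv> 2 * (1 - \<alpha>) / (5 + sqrt (25 + 4 * \<alpha> * (\<alpha> - 1)))"
  shows "0 < R" "R \<le> 1/5" "\<alpha> * (1 - R\<^sup>2) = 1 - 5 * R"
    "\<And>s. 0 \<le> s \<Longrightarrow> s < R \<Longrightarrow> \<alpha> * (1 - s\<^sup>2) < 1 - 5 * s"
proof -
  define D where "D = sqrt (25 + 4 * \<alpha> * (\<alpha> - 1))"
  have id: "25 + 4 * \<alpha> * (\<alpha> - 1) = 24 + (1 - 2 * \<alpha>)\<^sup>2" by (simp add: power2_eq_square algebra_simps)
  have D2: "D\<^sup>2 = 25 + 4 * \<alpha> * (\<alpha> - 1)" unfolding D_def by (rule real_sqrt_pow2) (simp add: id)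
  have D0: "0 \<le> D" unfolding D_def by (simp add: id)
  have R: "R = 2 * (1 - \<alpha>) / (5 + D)" by (simp add: R_def D_def)
  show pos: "0 < R" unfolding R using \<alpha> D0 by simp
  have eq: "R * (5 + D) = 2 * (1 - \<alpha>)" unfolding R using D0 by simp
  have "\<alpha> * R\<^sup>2 - 5 * R + (1 - \<alpha>) = 0"
  proof -
    \<comment> \<open>The multiplier \<open>4 (1 - \<alpha>)\<close> lets \<open>eq\<close> and \<open>D2\<close> eliminate \<open>\<alpha>\<close>.\<close>
    have "(1 - \<alpha>) * (\<alpha> * R\<^sup>2 - 5 * R + (1 - \<alpha>)) * 4
       = R\<^sup>2 * (4 * \<alpha> * (1 - \<alpha>)) - 10 * R * (2 * (1 - \<alpha>)) + (2 * (1 - \<alpha>))\<^sup>2"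
      by (simp add: power2_eq_square algebra_simps)
    also have "\<dots> = R\<^sup>2 * (25 - D\<^sup>2) - 10 * R * (R * (5 + D)) + (R * (5 + D))\<^sup>2"
      unfolding eq by (simp add: D2 algebra_simps)
    also have "\<dots> = 0" by (simp add: power2_eq_square algebra_simps)
    finally show ?thesis using \<alpha> by simp
  qed
  then show root: "\<alpha> * (1 - R\<^sup>2) = 1 - 5 * R" by (simp add: algebra_simps)
  show le: "R \<le> 1/5"
  proof (rule ccontr)
    assume "\<not> ?thesis"
    then have "\<alpha> * (1 - R\<^sup>2) < 0" using root by simp
    then have "1 - R\<^sup>2 < 0" using \<alpha> by (simp add: mult_less_0_iff)
    then have R1: "R > 1" using power_le_one[of R 2] pos by linarith
    have "5 \<le> 5 + D" using D0 by simp
    then have "R * 5 \<le> R * (5 + D)" using pos by simp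
    then show False using eq \<alpha> R1 by simp
  qed
  show "\<alpha> * (1 - s\<^sup>2) < 1 - 5 * s" if s: "0 \<le> s" "s < R" for s
  proof -
    have "\<alpha> * (R + s) < 5" using mult_mono[of \<alpha> 1 "R + s" 2] \<alpha> s le by simp
    then have "0 < (R - s) * (5 - \<alpha> * (R + s))" using s by simp
    also have "\<dots> = (1 - 5 * s - \<alpha> * (1 - s\<^sup>2)) - (1 - 5 * R - \<alpha> * (1 - R\<^sup>2))"
      by (simp add: power2_eq_square algebra_simps)
    finally show ?thesis using root by simp
  qed
qed

lemma convex_radius_class_F7:
  fixes \<alpha> :: real
  assumes \<alpha>: "0 \<le> \<alpha>" "\<alpha> < 1"
  shows "is_radius (convex_of_order \<alpha>) class_F7 (2 * (1 - \<alpha>) / (5 + sqrt (25 + 4 * \<alpha> * (\<alpha> - 1))))"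
proof -
  define R where "R = 2 * (1 - \<alpha>) / (5 + sqrt (25 + 4 * \<alpha> * (\<alpha> - 1)))"
  note R = radius_quadratic[OF \<alpha>, folded R_def]
  have "radius_admissible (convex_of_order \<alpha>) class_F7 R"
    unfolding radius_admissible_def
    using R(1,2) by (auto intro!: class_F7_dilation_convex_of_order R(4))
  moreover have "R' \<le> R" if R': "radius_admissible (convex_of_order \<alpha>) class_F7 R'" for R'
  proof (rule ccontr)
    assume "\<not> ?thesis"
    then have lt: "R < R'" by simp
    have "dilation R' F7_extremal \<in> convex_of_order \<alpha>" and R1: "R' \<le> 1"
      using R' lt R(1) F7_extremal_in_class by (auto simp: radius_admissible_def)
    then have "\<alpha> < (1 - 5 * R) / (1 - R\<^sup>2)"
      by (intro F7_extremal_dilation_convex_imp[OF _ lt]) (use R in auto)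
    moreover have "1 - R\<^sup>2 > 0" using R(1,2) by (simp add: abs_square_less_1)
    ultimately show False using R(3) by (simp add: pos_less_divide_eq)
  qed
  ultimately show ?thesis unfolding is_radius_def R_def[symmetric] by blast
qed

lemma radius_half: "2 * (1 - (1/2 :: real)) / (5 + sqrt (25 + 4 * (1/2) * (1/2 - 1))) = 5 - 2 * sqrt 6"
proof -
  have "sqrt 24 = sqrt (2\<^sup>2 * 6)" by simp
  also have "\<dots> = 2 * sqrt 6" unfolding real_sqrt_mult by simp
  finally have "2 * (1 - (1/2 :: real)) / (5 + sqrt (25 + 4 * (1/2) * (1/2 - 1))) = 1 / (5 + 2 * sqrt 6)"
    by simp
  moreover have "(5 - 2 * sqrt 6) * (5 + 2 * sqrt 6) = 1" by (simp add: algebra_simps)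
  moreover have "5 + 2 * sqrt 6 > 0" by (simp add: add_pos_nonneg)
  ultimately show ?thesis by (metis less_irrefl nonzero_eq_divide_eq)
qed

text \<open>Sharpness cannot be tested at the radius \<open>R\<close> itself, where the two-point condition holds
  with equality; a point \<open>s\<close> strictly between \<open>R\<close> and the larger candidate violates it, since
  \<open>s\<^sup>2 - 10 s + 1\<close> is negative between its roots \<open>R\<close> and \<open>10 - R\<close>.\<close>

lemma UCV_radius_class_F7: "is_radius UCV class_F7 (5 - 2 * sqrt 6)"
proof -
  define R :: real where "R = 5 - 2 * sqrt 6"
  note R = radius_quadratic[of "1/2", unfolded radius_half, folded R_def, simplified]
  have "radius_admissible UCV class_F7 R"
    unfolding radius_admissible_def
    using R(1,2) by (auto intro!: class_F7_dilation_UCV simp: R(4))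
  moreover have "R' \<le> R" if R': "radius_admissible UCV class_F7 R'" for R'
  proof (rule ccontr)
    assume "\<not> ?thesis"
    then obtain s where s: "R < s" "s < R'" using dense[of R R'] by auto
    have ucv: "dilation R' F7_extremal \<in> UCV" and R1: "R' \<le> 1"
      using R' s R(1) F7_extremal_in_class by (auto simp: radius_admissible_def)
    have "1/2 \<le> (1 - 5 * s) / (1 - s\<^sup>2)"
      by (rule F7_extremal_dilation_UCV_imp[OF _ s(2) R1 ucv]) (use s R in auto)
    moreover have "1 - s\<^sup>2 > 0" using s R(1) R1 by (simp add: abs_square_less_1)
    ultimately have "1 - s\<^sup>2 \<le> 2 * (1 - 5 * s)" by (simp add: pos_le_divide_eq)
    moreover have "(s - R) * (10 - (s + R)) > 0" using s R R1 by simp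
    ultimately show False using R(3) by (simp add: power2_eq_square algebra_simps)
  qed
  ultimately show ?thesis unfolding is_radius_def R_def[symmetric] by blast
qed

theorem theorem3p2:
  shows "(\<forall>\<alpha>::real. 0 \<le> \<alpha> \<and> \<alpha> < 1 \<longrightarrow>
            is_radius (convex_of_order \<alpha>) class_F7
              (2 * (1 - \<alpha>) / (5 + sqrt (25 + 4 * \<alpha> * (\<alpha> - 1))))) \<and>
         is_radius UCV class_F7 (5 - 2 * sqrt 6) \<and>
         is_radius (convex_of_order (1 / 2)) class_F7 (5 - 2 * sqrt 6)"
  using convex_radius_class_F7 UCV_radius_class_F7 convex_radius_class_F7[of "1/2", unfolded radius_half]
  by simp

end
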